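(* Let $n$, $\epsilon=\epsilon(n)\in(0,1)$ and a finite universe $U=U(n)$ be parameters with $\epsilon=o(1)$ and $|U|=\omega(n\epsilon^{-1})$ as $n\to\infty$. Any algorithm that implements a dynamic filter with universe $U$, capacity $n$ and false-positive error rate $\epsilon$, and that can support a sequence of $\omega(n)$ insertions and deletions, must use space at least $n\log \epsilon^{-1}+n\log e-o(n)$ bits.
   Context: All logarithms are base 2. Computational model: the data structure uses a fixed-length memory of some number $h$ of bits (its space), which can be accessed arbitrarily, and additionally has access to an infinite read-only tape of independent uniformly random bits that does not count towards the space. A dynamic filter with universe $U$, capacity $n$ and false-positive rate $\epsilon$ maintains a set $S\subseteq U$ with $|S|\le n$ (the true key set), starting from the state returned by Initialize() with $S=\emptyset$, and supports: Insert($x$) (assumes $x\notin S$; sets $S:=S\cup\{x\}$), Delete($x$) (assumes $x\in S$; sets $S:=S\setminus\{x\}$), and Query($x$), which must return true deterministically for every $x\in S$, and for every $x\notin S$ must return false with probability at least $1-\epsilon$ over the random tape (the key $x$ is not random). Updates may only use the memory contents, the argument $x$, and the random tape; the filter does not know $S$ explicitly. "Can support a sequence of $\omega(n)$ insertions and deletions" means these guarantees hold for operation sequences of some length $f(n)=\omega(n)$ (the lower bound holds for any such $f$). *)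

theory Defs
  imports "HOL-Probability.Probability" "HOL-Library.Landau_Symbols"
begin

type_synonym tape = "nat \<Rightarrow> bool"

definition tape_space :: "tape measure" where
  "tape_space = PiM UNIV (\<lambda>_. measure_pmf (bernoulli_pmf (1 / 2)))"

datatype 'u update = Ins 'u | Del 'u

text \<open>
  Every operation receives the same read-only tape, the argument key and the current memory
  contents, and nothing else. Queries are given no way to change the memory. This loses no
  generality: the requirements below only concern a query asked after a sequence of updates,
  so a memory modified by that query would never be looked at again.
\<close>
record 'u filter_alg =
  alg_init :: "tape \<Rightarrow> bool list"
  alg_insert :: "tape \<Rightarrow> 'u \<Rightarrow> bool list \<Rightarrow> bool list"
  alg_delete :: "tape \<Rightarrow> 'u \<Rightarrow> bool list \<Rightarrow> bool list"
  alg_query :: "tape \<Rightarrow> 'u \<Rightarrow> bool list \<Rightarrow> bool"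

fun alg_update :: "'u filter_alg \<Rightarrow> tape \<Rightarrow> 'u update \<Rightarrow> bool list \<Rightarrow> bool list" where
  "alg_update A t (Ins x) m = alg_insert A t x m"
| "alg_update A t (Del x) m = alg_delete A t x m"

definition memory_after :: "'u filter_alg \<Rightarrow> tape \<Rightarrow> 'u update list \<Rightarrow> bool list" where
  "memory_after A t us = fold (alg_update A t) us (alg_init A t)"

fun set_update :: "'u update \<Rightarrow> 'u set \<Rightarrow> 'u set" where
  "set_update (Ins x) S = insert x S"
| "set_update (Del x) S = S - {x}"

definition keys_after :: "'u update list \<Rightarrow> 'u set" where
  "keys_after us = fold set_update us {}"

fun admissible_from :: "'u set \<Rightarrow> nat \<Rightarrow> 'u set \<Rightarrow> 'u update list \<Rightarrow> bool" where
  "admissible_from U n S [] \<longleftrightarrow> True"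
| "admissible_from U n S (Ins x # us) \<longleftrightarrow>
     x \<in> U \<and> x \<notin> S \<and> card (insert x S) \<le> n \<and> admissible_from U n (insert x S) us"
| "admissible_from U n S (Del x # us) \<longleftrightarrow>
     x \<in> S \<and> admissible_from U n (S - {x}) us"

definition admissible :: "'u set \<Rightarrow> nat \<Rightarrow> 'u update list \<Rightarrow> bool" where
  "admissible U n us \<longleftrightarrow> admissible_from U n {} us"

text \<open>
  The measurability conditions express that operations are random variables on the tape; they
  hold for any operation whose outcome is determined by the finitely many tape cells it reads.
\<close>
definition uses_space :: "'u filter_alg \<Rightarrow> 'u set \<Rightarrow> nat \<Rightarrow> bool" where
  "uses_space A U h \<longleftrightarrow>
     (\<forall>t. length (alg_init A t) = h) \<and>
     (\<forall>t. \<forall>x\<in>U. \<forall>m. length m = h \<longrightarrow>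
        length (alg_insert A t x m) = h \<and> length (alg_delete A t x m) = h) \<and>
     alg_init A \<in> measurable tape_space (count_space UNIV) \<and>
     (\<forall>x\<in>U. \<forall>m. length m = h \<longrightarrow>
        (\<lambda>t. alg_insert A t x m) \<in> measurable tape_space (count_space UNIV) \<and>
        (\<lambda>t. alg_delete A t x m) \<in> measurable tape_space (count_space UNIV) \<and>
        (\<lambda>t. alg_query A t x m) \<in> measurable tape_space (count_space UNIV))"

text \<open>
  The updates and the queried key are fixed before the tape is drawn. The bound \<open>l\<close> limits the
  number of updates; allowing fewer than \<open>l\<close> of them means that the guarantees hold at every
  point of a sequence of length \<open>l\<close>, not just at its end.
\<close>
definition dynamic_filter ::
  "'u filter_alg \<Rightarrow> 'u set \<Rightarrow> nat \<Rightarrow> real \<Rightarrow> nat \<Rightarrow> nat \<Rightarrow> bool" where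
  "dynamic_filter A U n \<epsilon> l h \<longleftrightarrow>
     uses_space A U h \<and>
     (\<forall>us. admissible U n us \<and> length us \<le> l \<longrightarrow>
        (\<forall>x\<in>keys_after us. \<forall>t. alg_query A t x (memory_after A t us)) \<and>
        (\<forall>x\<in>U - keys_after us.
           measure tape_space {t \<in> space tape_space. \<not> alg_query A t x (memory_after A t us)}
             \<ge> 1 - \<epsilon>))"

end

theory Submission
  imports Defs "HOL-Real_Asymp.Real_Asymp"
begin

text \<open>
  Run the filter on distinct random keys \<open>K\<^sub>0, K\<^sub>1, \<dots>\<close>, deleting each key \<open>n\<close> insertions after it was
  inserted, and let \<open>Q\<^sub>j\<close> be the set of accepted keys after \<open>j\<close> insertions. Consider a block
  \<open>K\<^sub>a, \<dots>, K\<^bsub>a+n-1\<^esub>\<close> and decode it from the memory after step \<open>a + n\<close> and all keys outside the block.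
  Once \<open>K\<^sub>a, \<dots>, K\<^bsub>a+k-1\<^esub>\<close> are known, one can compute \<open>Q\<^bsub>a+k\<^esub>\<close> by replaying the block from its start,
  and \<open>Q\<^bsub>a+n\<^esub>, \<dots>, Q\<^bsub>a+n+k\<^esub>\<close> by replaying the next block from the given memory. The key \<open>K\<^bsub>a+k\<^esub>\<close>
  lies in all of the latter sets, and except with probability \<open>\<epsilon>\<close> it does not lie in \<open>Q\<^bsub>a+k\<^esub>\<close>.

  For a fixed key \<open>u\<close>, the positions \<open>a\<close> with \<open>u \<notin> Q\<^bsub>a+k\<^esub>\<close> and \<open>u \<in> Q\<^bsub>a+n\<^esub> \<inter> \<dots> \<inter> Q\<^bsub>a+n+k\<^esub>\<close> make up at most
  a fraction \<open>(n - k) / n\<close> of the positions \<open>j\<close> with \<open>u \<in> Q\<^sub>j\<close>. So for an average block there are only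
  about \<open>\<epsilon> |U| (n - k) / n\<close> candidates for \<open>K\<^bsub>a+k\<^esub>\<close>, and the memory has to supply
  \<open>n log (1 / \<epsilon>) + log (n^n / n!)\<close> bits. The sequence has length \<open>\<omega>(n)\<close> so that the boundary of the range
  of block positions is negligible.
\<close>

section \<open>Combinatorial and entropy inequalities\<close>

text \<open>If \<open>q xs\<close> is read as a sub-distribution of the next letter after the prefix
  \<open>xs\<close>, the products form a sub-distribution on words. The induction splits off the
  first letter, which shifts \<open>q\<close>; hence \<open>q\<close> is generalised.\<close>

lemma kraft_sum:
  fixes q :: "'u list \<Rightarrow> 'u \<Rightarrow> real"
  assumes "finite U" and "\<And>xs u. 0 \<le> q xs u"
    and "\<And>xs. length xs < n \<Longrightarrow> (\<Sum>u\<in>U. q xs u) \<le> 1"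
  shows "(\<Sum>xs\<in>{xs. set xs \<subseteq> U \<and> length xs = n}. \<Prod>k<n. q (take k xs) (xs ! k)) \<le> 1"
  using assms(2,3)
proof (induction n arbitrary: q)
  case 0
  have "{xs. set xs \<subseteq> U \<and> length xs = 0} = {[]}" by auto
  then show ?case by simp
next
  case (Suc n)
  let ?L = "\<lambda>n. {xs. set xs \<subseteq> U \<and> length xs = n}"
  have L: "?L (Suc n) = (\<lambda>(u, xs). u # xs) ` (U \<times> ?L n)"
    by (auto simp: length_Suc_conv image_iff)
  have "(\<Sum>xs\<in>?L (Suc n). \<Prod>k<Suc n. q (take k xs) (xs ! k))
      = (\<Sum>(u, xs)\<in>U \<times> ?L n. \<Prod>k<Suc n. q (take k (u # xs)) ((u # xs) ! k))"
    unfolding L by (subst sum.reindex) (auto simp: inj_on_def case_prod_unfold)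
  also have "\<dots> = (\<Sum>u\<in>U. q [] u * (\<Sum>xs\<in>?L n. \<Prod>k<n. q (u # take k xs) (xs ! k)))"
    by (simp add: sum.cartesian_product[symmetric] prod.lessThan_Suc_shift sum_distrib_left
        del: prod.lessThan_Suc)
  also have "\<dots> \<le> (\<Sum>u\<in>U. q [] u * 1)"
  proof (intro sum_mono mult_left_mono)
    fix u
    show "(\<Sum>xs\<in>?L n. \<Prod>k<n. q (u # take k xs) (xs ! k)) \<le> 1"
      using Suc.prems by (intro Suc.IH[where q = "\<lambda>xs. q (u # xs)"]) auto
  qed (use Suc.prems in auto)
  also have "\<dots> \<le> 1" using Suc.prems(2)[of "[]"] by simp
  finally show ?case .
qed

lemma card_gap_then_run_le:
  fixes b :: "nat \<Rightarrow> bool"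
  assumes k: "k < n" and N: "T + 2 * n \<le> N"
  shows "n * card {a. a < T \<and> \<not> b (a + k) \<and> (\<forall>j\<le>k. b (a + n + j))}
    \<le> (n - k) * card {j. j < N \<and> b j}"
proof -
  \<comment> \<open>\<open>R j\<close>: the starts (last zero before) of the runs of length at least \<open>j\<close>. A counted \<open>a\<close> is determined by
    the start of the run through \<open>a + n\<close> and the distance from it to \<open>a + n + k\<close>, which is in \<open>{k+1..n}\<close>; and
    \<open>card (R j)\<close> decreases in \<open>j\<close>.\<close>
  define R where "R = (\<lambda>j. {z. z + j < N \<and> \<not> b z \<and> (\<forall>i\<in>{1..j}. b (z + i))})"
  define c where "c = (\<lambda>j. card (R j))"
  define X where "X = {a. a < T \<and> \<not> b (a + k) \<and> (\<forall>j\<le>k. b (a + n + j))}"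
  define last0 where "last0 = (\<lambda>a. Max {z. z < a + n \<and> \<not> b z})"
  have fin: "finite (R j)" for j
    by (rule finite_subset[of _ "{..<N}"]) (auto simp: R_def)
  have c_mono: "c j \<le> c i" if "i \<le> j" for i j
    unfolding c_def using that fin by (intro card_mono) (auto simp: R_def)
  have last0: "a + k \<le> last0 a" "last0 a < a + n" "\<not> b (last0 a)"
      "\<And>i. last0 a < i \<Longrightarrow> i < a + n \<Longrightarrow> b i" if "a \<in> X" for a
  proof -
    let ?Z = "{z. z < a + n \<and> \<not> b z}"
    have f: "finite ?Z" by simp
    have m: "a + k \<in> ?Z" using that k by (auto simp: X_def)
    show "a + k \<le> last0 a" unfolding last0_def using f m by (rule Max_ge)
    have "Max ?Z \<in> ?Z" using f m by (intro Max_in) blast+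
    then show "last0 a < a + n" "\<not> b (last0 a)" by (auto simp: last0_def)
    show "b i" if "last0 a < i" "i < a + n" for i
      using that Max_ge[OF f, of i] unfolding last0_def by fastforce
  qed
  have "card X \<le> card (Sigma {k+1..n} R)"
  proof (rule card_inj_on_le[where f = "\<lambda>a. (a + n + k - last0 a, last0 a)"])
    show "inj_on (\<lambda>a. (a + n + k - last0 a, last0 a)) X"
    proof (rule inj_onI)
      fix a a' assume "a \<in> X" "a' \<in> X"
        "(a + n + k - last0 a, last0 a) = (a' + n + k - last0 a', last0 a')"
      then show "a = a'" using last0(2)[of a] last0(2)[of a'] by auto
    qed
    show "(\<lambda>a. (a + n + k - last0 a, last0 a)) ` X \<subseteq> Sigma {k+1..n} R"
    proof (rule image_subsetI)
      fix a assume a: "a \<in> X"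
      note l = last0[OF a]
      have "b (last0 a + i)" if "i \<in> {1..a + n + k - last0 a}" for i
      proof (cases "last0 a + i < a + n")
        case True then show ?thesis using l(4) that by auto
      next
        case False
        then have "b (a + n + (last0 a + i - (a + n)))"
          using a that l unfolding X_def by (intro a[unfolded X_def, simplified, THEN conjunct2, THEN conjunct2, rule_format]) auto
        then show ?thesis using False by simp
      qed
      then show "(a + n + k - last0 a, last0 a) \<in> Sigma {k+1..n} R"
        using l a k N by (auto simp: R_def X_def)
    qed
    show "finite (Sigma {k+1..n} R)" using fin by auto
  qed
  also have "\<dots> = sum c {k+1..n}" using fin by (simp add: c_def card_SigmaI)
  finally have 1: "card X \<le> sum c {k+1..n}" .
  \<comment> \<open>In such a pair \<open>z\<close> is the last zero before the position
    \<open>z + j\<close>, so distinct pairs give distinct positions satisfying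
    \<open>b\<close>.\<close>
  have "sum c {1..n} = card (Sigma {1..n} R)" using fin by (simp add: c_def card_SigmaI)
  also have "\<dots> \<le> card {j. j < N \<and> b j}"
  proof (rule card_inj_on_le[where f = "\<lambda>(j, z). z + j"])
    have *: False if "(j, z) \<in> Sigma {1..n} R" "(j', z') \<in> Sigma {1..n} R" "z + j = z' + j'" "z < z'"
      for j z j' z'
    proof -
      have "z' - z \<in> {1..j}" using that by auto
      then have "b (z + (z' - z))" using that(1) by (auto simp: R_def)
      then show False using that by (auto simp: R_def)
    qed
    show "inj_on (\<lambda>(j, z). z + j) (Sigma {1..n} R)"
    proof (rule inj_onI, clarify)
      fix j z j' z'
      assume A: "j \<in> {1..n}" "z \<in> R j" "j' \<in> {1..n}" "z' \<in> R j'" "z + j = z' + j'"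
      have "z = z'" using *[of j z j' z'] *[of j' z' j z] A by (metis SigmaI linorder_neqE_nat)
      then show "j = j' \<and> z = z'" using A by auto
    qed
  qed (auto simp: R_def)
  finally have 2: "sum c {1..n} \<le> card {j. j < N \<and> b j}" .
  have S: "sum c {1..n} = sum c {1..k} + sum c {k+1..n}"
    using k sum.ub_add_nat[of 1 k c "n - k"] by simp
  \<comment> \<open>Both parts of the sum are compared with \<open>c (k+1)\<close>: as
    \<open>c\<close> decreases, the average of its last \<open>n - k\<close> values is at most that
    of all \<open>n\<close>.\<close>
  have "sum c {k+1..n} \<le> (\<Sum>j\<in>{k+1..n}. c (k+1))" by (intro sum_mono c_mono) auto
  then have "sum c {k+1..n} \<le> (n - k) * c (k+1)" by simp
  then have "k * sum c {k+1..n} \<le> (n - k) * (k * c (k+1))"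
    by (metis mult.left_commute mult_le_mono2)
  also have "k * c (k+1) \<le> sum c {1..k}"
    using sum_mono[of "{1..k}" "\<lambda>_. c (k+1)" c] c_mono by simp
  finally have "k * sum c {k+1..n} \<le> (n - k) * sum c {1..k}" by simp
  then have "n * sum c {k+1..n} \<le> (n - k) * sum c {1..n}"
  proof -
    obtain d where d: "n = k + d" using k less_imp_add_positive by blast
    show ?thesis using \<open>k * sum c {k+1..n} \<le> (n - k) * sum c {1..k}\<close>
      unfolding S by (simp add: d algebra_simps)
  qed
  then show ?thesis using 1 2 unfolding X_def[symmetric]
    by (meson le_trans mult_le_mono2)
qed

text \<open>Jensen's inequality for \<open>ln\<close>, from its tangent at the mean.\<close>

lemma sum_ln_le_ln_mean:
  fixes x :: "'a \<Rightarrow> real"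
  assumes "finite I" "I \<noteq> {}" and pos: "\<And>i. i \<in> I \<Longrightarrow> 0 < x i"
  shows "(\<Sum>i\<in>I. ln (x i)) \<le> real (card I) * ln ((\<Sum>i\<in>I. x i) / real (card I))"
proof -
  define \<mu> where "\<mu> = (\<Sum>i\<in>I. x i) / real (card I)"
  have c: "real (card I) > 0" using assms by (simp add: card_gt_0_iff)
  have \<mu>: "\<mu> > 0" unfolding \<mu>_def using assms c by (intro divide_pos_pos sum_pos) auto
  have "ln (x i) \<le> ln \<mu> + (x i / \<mu> - 1)" if "i \<in> I" for i
    using ln_le_minus_one[of "x i / \<mu>"] pos[OF that] \<mu> by (simp add: ln_div)
  then have "(\<Sum>i\<in>I. ln (x i)) \<le> (\<Sum>i\<in>I. ln \<mu> + (x i / \<mu> - 1))" by (rule sum_mono)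
  also have "\<dots> = real (card I) * ln \<mu> + ((\<Sum>i\<in>I. x i) / \<mu> - real (card I))"
    by (simp add: sum.distrib sum_subtractf sum_divide_distrib)
  also have "(\<Sum>i\<in>I. x i) / \<mu> = real (card I)"
    using c \<mu> by (simp add: \<mu>_def field_simps)
  finally show ?thesis by (simp add: \<mu>_def)
qed

section \<open>Sliding-window runs of a deterministic machine\<close>

text \<open>The start index \<open>i\<close> allows a run to be resumed from a stored memory, as the
  decoder does when it replays the block after the unknown one.\<close>

primrec window_run :: "('u \<Rightarrow> 'm \<Rightarrow> 'm) \<Rightarrow> ('u \<Rightarrow> 'm \<Rightarrow> 'm) \<Rightarrow> nat \<Rightarrow> (nat \<Rightarrow> 'u) \<Rightarrow> nat \<Rightarrow> nat \<Rightarrow> 'm \<Rightarrow> 'm"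
  where
  "window_run ins del n K i 0 m = m"
| "window_run ins del n K i (Suc d) m =
    (let m' = window_run ins del n K i d m
     in ins (K (i + d)) (if i + d < n then m' else del (K (i + d - n)) m'))"

lemma window_run_add:
  "window_run ins del n K i (d + e) m = window_run ins del n K (i + d) e (window_run ins del n K i d m)"
  by (induction e) (simp_all add: Let_def ac_simps)

text \<open>Isolates the keys that a run reads, so that the decoder can replay it with an
  incompletely known sequence.\<close>

lemma window_run_cong:
  assumes "\<And>e. e < d \<Longrightarrow> K (i + e) = K' (i + e)"
    and "\<And>e. e < d \<Longrightarrow> n \<le> i + e \<Longrightarrow> K (i + e - n) = K' (i + e - n)"
  shows "window_run ins del n K i d m = window_run ins del n K' i d m"
  using assms by (induction d) (simp_all add: Let_def)

lemma window_run_closed: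
  assumes "m \<in> M" and "\<And>e. e < i + d \<Longrightarrow> K e \<in> U"
    and "\<And>x m. x \<in> U \<Longrightarrow> m \<in> M \<Longrightarrow> ins x m \<in> M \<and> del x m \<in> M"
  shows "window_run ins del n K i d m \<in> M"
  using assms(2)
proof (induction d)
  case 0 then show ?case using assms(1) by simp
next
  case (Suc d)
  then show ?case using assms(3) by (simp add: Let_def less_imp_diff_less)
qed

lemma sum_shift_le:
  fixes g :: "nat \<Rightarrow> real"
  assumes "T + k \<le> N" and "\<And>i. 0 \<le> g i"
  shows "(\<Sum>a<T. g (a + k)) \<le> (\<Sum>i<N. g i)"
proof -
  have "(\<Sum>a<T. g (a + k)) = sum g ((\<lambda>a. a + k) ` {..<T})"
    by (subst sum.reindex) (auto simp: inj_on_def)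
  also have "\<dots> \<le> sum g {..<N}" using assms by (intro sum_mono2) auto
  finally show ?thesis .
qed

lemma sum_card_swap:
  assumes "finite A" "finite B" "\<And>a. a \<in> A \<Longrightarrow> S a \<subseteq> B"
  shows "(\<Sum>a\<in>A. card (S a)) = (\<Sum>u\<in>B. card {a \<in> A. u \<in> S a})"
proof -
  have "(\<Sum>a\<in>A. card (S a)) = (\<Sum>a\<in>A. card {u \<in> B. u \<in> S a})"
    using assms(3) by (intro sum.cong arg_cong[of _ _ card]) auto
  also have "\<dots> = (\<Sum>u\<in>B. card {a \<in> A. u \<in> S a})"
    using assms(1,2) by (intro sum_multicount_gen) auto
  finally show ?thesis .
qed

section \<open>Encoding argument for a deterministic filter\<close>

text \<open>A filter with its tape fixed. No error bound is assumed; false positives enter later,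
  through the sizes of the accepted sets and the number of keys accepted too early.\<close>

locale sliding_window =
  fixes ins del :: "'u \<Rightarrow> 'm \<Rightarrow> 'm" and acc :: "'m \<Rightarrow> 'u set" and m0 :: 'm
    and n N :: nat and U :: "'u set" and M :: "'m set" and \<eta> :: real
  assumes finite_U: "finite U" and finite_M: "finite M" and init_closed: "m0 \<in> M"
    and step_closed: "\<And>x m. x \<in> U \<Longrightarrow> m \<in> M \<Longrightarrow> ins x m \<in> M \<and> del x m \<in> M"
    and acc_subset: "\<And>m. acc m \<subseteq> U"
    and complete: "\<And>K i j. \<lbrakk>set K \<subseteq> U; length K = N; distinct K; j \<le> N; i < j; j \<le> i + n\<rbrakk>
      \<Longrightarrow> K ! i \<in> acc (window_run ins del n ((!) K) 0 j m0)"
    and eta: "0 < \<eta>" "\<eta> \<le> 1"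
begin

definition keyseqs :: "'u list set" where
  "keyseqs = {K. set K \<subseteq> U \<and> length K = N \<and> distinct K}"

definition Q :: "'u list \<Rightarrow> nat \<Rightarrow> 'u set" where
  "Q K j = acc (window_run ins del n ((!) K) 0 j m0)"

text \<open>The candidates for \<open>K ! (a + k)\<close>. The times stop at
  \<open>a + n + k\<close> because the replay up to there deletes only keys of the block before
  index \<open>a + k\<close>, which are already decoded.\<close>

definition C :: "nat \<Rightarrow> 'u list \<Rightarrow> nat \<Rightarrow> 'u set" where
  "C a K k = (\<Inter>j\<le>k. Q K (a + n + j))"

text \<open>
  A key in the accepted set before its insertion is encoded with the small probability weight \<open>\<eta>\<close>,
  any other key with weight \<open>1\<close>; \<open>cost\<close> bounds the total weight of the candidates.
\<close>
definition cost :: "nat \<Rightarrow> 'u list \<Rightarrow> nat \<Rightarrow> real" where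
  "cost a K k = real (card (C a K k - Q K (a + k))) + \<eta> * real (card (C a K k))"

definition weight :: "'u list \<Rightarrow> nat \<Rightarrow> real" where
  "weight K i = (if K ! i \<in> Q K i then \<eta> else 1)"

lemma finite_keyseqs: "finite keyseqs"
  by (rule finite_subset[OF _ finite_lists_length_eq[OF finite_U, of N]]) (auto simp: keyseqs_def)

lemma Q_subset: "Q K j \<subseteq> U" unfolding Q_def by (rule acc_subset)

lemma finite_Q: "finite (Q K j)" by (rule finite_subset[OF Q_subset finite_U])

lemma C_subset: "C a K k \<subseteq> Q K (a + n)"
  unfolding C_def using INT_lower[of 0 "{..k}" "\<lambda>j. Q K (a + n + j)"]
  by (simp only: atMost_iff le0 add_0_right)

lemma finite_C: "finite (C a K k)" by (rule finite_subset[OF C_subset finite_Q])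

lemma key_in_C:
  assumes "K \<in> keyseqs" "k < n" "a + 2 * n \<le> N"
  shows "K ! (a + k) \<in> C a K k"
proof -
  have "K ! (a + k) \<in> Q K (a + n + j)" if "j \<le> k" for j
    unfolding Q_def using assms that by (intro complete) (auto simp: keyseqs_def)
  then show ?thesis by (simp add: C_def)
qed

lemma cost_pos:
  assumes "K \<in> keyseqs" "k < n" "a + 2 * n \<le> N"
  shows "0 < cost a K k"
proof -
  have "0 < card (C a K k)" using key_in_C[OF assms] finite_C card_gt_0_iff by blast
  then have "0 < \<eta> * real (card (C a K k))" using eta by simp
  then show ?thesis unfolding cost_def by linarith
qed

lemma weight_pos: "0 < weight K i" using eta by (simp add: weight_def)

text \<open>Once the keys outside the block and the memory after step \<open>a + n\<close> are
  fixed, the summand is a code weight of the block, and \<open>kraft_sum\<close> bounds the total by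
  1. The right-hand side counts the possible values of what was fixed.\<close>

lemma block_kraft:
  assumes aN: "a + 2 * n \<le> N"
  shows "(\<Sum>K\<in>keyseqs. \<Prod>k<n. weight K (a + k) / cost a K k)
    \<le> real (card M) * real (card U) ^ (N - n)"
proof -
  define L where "L = (\<lambda>l. {xs. set xs \<subseteq> U \<and> length xs = l})"
  define G where "G = (\<lambda>pre xs post i.
      if i < a then pre ! i else if i < a + length xs then xs ! (i - a) else post ! (i - (a + n)) :: 'u)"
  \<comment> \<open>\<open>P\<close> and \<open>E\<close> recompute \<open>Q\<close> and \<open>C\<close> from what the decoder knows. The junk values that \<open>G\<close> takes inside
    the block beyond the known prefix \<open>xs\<close> are never read.\<close>
  define P where "P = (\<lambda>pre post xs.
      acc (window_run ins del n (G pre xs post) 0 (a + length xs) m0))"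
  define E where "E = (\<lambda>pre post m xs. \<Inter>j\<le>length xs.
      acc (window_run ins del n (G pre xs post) (a + n) j m))"
  define q where "q = (\<lambda>(pre, post, m) xs u.
      (if u \<in> E pre post m xs then if u \<in> P pre post xs then \<eta> else 1 else 0)
      / (real (card (E pre post m xs - P pre post xs)) + \<eta> * real (card (E pre post m xs))))"
  define W where "W = (\<lambda>(y, xs). \<Prod>k<n. q y (take k xs) (xs ! k))"
  define \<phi> where "\<phi> = (\<lambda>K. ((take a K, drop (a + n) K, window_run ins del n ((!) K) 0 (a + n) m0),
      take n (drop a K)))"
  have finL: "finite (L l)" for l unfolding L_def by (rule finite_lists_length_eq[OF finite_U])
  have cardL: "card (L l) = card U ^ l" for l unfolding L_def by (rule card_lists_length_eq[OF finite_U])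
  have E_U: "E pre post m xs \<subseteq> U" for pre post m xs
    unfolding E_def by (rule order_trans[OF INT_lower[of 0] acc_subset]) (simp only: atMost_iff le0)
  have finE: "finite (E pre post m xs)" for pre post m xs
    by (rule finite_subset[OF E_U finite_U])
  have q_nonneg: "0 \<le> q y xs u" for y xs u
    using eta by (cases y) (auto simp: q_def)
  have q_sum: "(\<Sum>u\<in>U. q y xs u) \<le> 1" for y xs
  proof -
    obtain pre post m where y: "y = (pre, post, m)" by (cases y)
    define e where "e = E pre post m xs"
    define p where "p = P pre post xs"
    have fe: "finite e" and eU: "e \<subseteq> U" using finE E_U by (auto simp: e_def)
    have "(\<Sum>u\<in>U. (if u \<in> e then if u \<in> p then \<eta> else 1 else 0))
        = (\<Sum>u\<in>e. if u \<in> p then \<eta> else 1)"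
      using eU finite_U by (simp add: sum.If_cases Int_absorb1)
    also have "\<dots> = \<eta> * real (card (e \<inter> p)) + real (card (e - p))"
      using fe by (simp add: sum.If_cases Diff_eq)
    also have "\<dots> \<le> \<eta> * real (card e) + real (card (e - p))"
      using eta fe by (intro add_right_mono mult_left_mono) (auto intro: card_mono)
    finally have "(\<Sum>u\<in>U. (if u \<in> e then if u \<in> p then \<eta> else 1 else 0))
        \<le> real (card (e - p)) + \<eta> * real (card e)" by simp
    moreover have "(\<Sum>u\<in>U. q y xs u) = (\<Sum>u\<in>U. (if u \<in> e then if u \<in> p then \<eta> else 1 else 0))
        / (real (card (e - p)) + \<eta> * real (card e))"
      unfolding y q_def prod.case e_def[symmetric] p_def[symmetric] by (simp add: sum_divide_distrib)
    moreover have "0 \<le> real (card (e - p)) + \<eta> * real (card e)" using eta by simp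
    \<comment> \<open>If the denominator vanishes, the quotient is 0 by convention.\<close>
    ultimately show ?thesis by (simp add: divide_le_eq_1 less_le)
  qed
  have inj: "inj_on \<phi> keyseqs"
  proof (rule inj_onI)
    fix K K' assume "\<phi> K = \<phi> K'"
    then have "take a K = take a K'" "drop (a + n) K = drop (a + n) K'" "take n (drop a K) = take n (drop a K')"
      by (auto simp: \<phi>_def)
    then show "K = K'"
      by (metis append_take_drop_id drop_drop add.commute)
  qed
  have V: "(\<Prod>k<n. weight K (a + k) / cost a K k) = W (\<phi> K)" if K: "K \<in> keyseqs" for K
  proof -
    let ?pre = "take a K" and ?post = "drop (a + n) K" and ?xs = "take n (drop a K)"
    let ?m = "window_run ins del n ((!) K) 0 (a + n) m0"
    have len: "length K = N" using K by (simp add: keyseqs_def)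
    have "weight K (a + k) / cost a K k = q (?pre, ?post, ?m) (take k ?xs) (?xs ! k)" if k: "k < n" for k
    proof -
      define H where "H = G ?pre (take k ?xs) ?post"
      have lk: "length (take k ?xs) = k" using len k aN by simp
      have G1: "H i = K ! i" if "i < a + k" for i
        using that len k aN unfolding H_def G_def lk by auto
      have G2: "H i = K ! i" if "a + n \<le> i" for i
        using that len k aN unfolding H_def G_def lk by auto
      have p: "P ?pre ?post (take k ?xs) = Q K (a + k)"
        unfolding P_def Q_def lk H_def[symmetric] by (intro arg_cong[of _ _ acc] window_run_cong) (auto simp: G1)
      have e: "E ?pre ?post ?m (take k ?xs) = C a K k"
      proof -
        have "window_run ins del n H (a + n) j ?m = window_run ins del n ((!) K) 0 (a + n + j) m0"
          if "j \<le> k" for j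
          using that unfolding window_run_add[of _ _ _ _ 0 "a + n" j] add_0
          by (intro window_run_cong) (auto simp: G1 G2)
        then show ?thesis unfolding E_def C_def Q_def lk H_def[symmetric] by auto
      qed
      have x: "?xs ! k = K ! (a + k)" using k len aN by simp
      show ?thesis
        using key_in_C[OF K k aN] unfolding q_def x prod.case p e weight_def cost_def by simp
    qed
    then show ?thesis by (simp add: W_def \<phi>_def)
  qed
  have sub: "\<phi> ` keyseqs \<subseteq> (L a \<times> L (N - (a + n)) \<times> M) \<times> L n"
  proof (rule image_subsetI)
    fix K assume K: "K \<in> keyseqs"
    then have "window_run ins del n ((!) K) 0 (a + n) m0 \<in> M"
      using aN step_closed init_closed
      by (intro window_run_closed[where U = U]) (auto simp: keyseqs_def)
    then show "\<phi> K \<in> (L a \<times> L (N - (a + n)) \<times> M) \<times> L n"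
      using K aN by (auto simp: \<phi>_def L_def keyseqs_def dest: in_set_takeD in_set_dropD)
  qed
  have "(\<Sum>K\<in>keyseqs. \<Prod>k<n. weight K (a + k) / cost a K k) = (\<Sum>y\<in>\<phi> ` keyseqs. W y)"
    unfolding sum.reindex[OF inj] using V by simp
  also have "\<dots> \<le> (\<Sum>y\<in>(L a \<times> L (N - (a + n)) \<times> M) \<times> L n. W y)"
    using sub finL finite_M q_nonneg
    by (intro sum_mono2) (auto simp: W_def case_prod_unfold intro!: prod_nonneg)
  also have "\<dots> = (\<Sum>y\<in>L a \<times> L (N - (a + n)) \<times> M. \<Sum>xs\<in>L n. W (y, xs))"
    by (simp add: sum.cartesian_product)
  also have "\<dots> \<le> (\<Sum>y\<in>L a \<times> L (N - (a + n)) \<times> M. 1)"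
    unfolding W_def L_def prod.case
    by (intro sum_mono kraft_sum[OF finite_U]) (auto simp: q_nonneg q_sum)
  also have "\<dots> = real (card U ^ a * (card U ^ (N - (a + n)) * card M))"
    by (simp add: card_cartesian_product cardL)
  also have "\<dots> = real (card M) * real (card U) ^ (a + (N - (a + n)))"
    by (simp add: power_add)
  also have "a + (N - (a + n)) = N - n" using aN by simp
  finally show ?thesis .
qed

text \<open>Double counting by keys: \<open>card_gap_then_run_le\<close> is applied to the times at
  which a given key is accepted. The \<open>\<eta>\<close> part is bounded crudely by
  \<open>C a K k \<subseteq> Q K (a + n)\<close>.\<close>

lemma sum_cost_le:
  assumes k: "k < n" and TN: "T + 2 * n \<le> N"
  shows "(\<Sum>a<T. cost a K k) \<le> (real (n - k) / real n + \<eta>) * (\<Sum>j<N. real (card (Q K j)))"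
proof -
  have "n * (\<Sum>a<T. card (C a K k - Q K (a + k)))
      = (\<Sum>u\<in>U. n * card {a \<in> {..<T}. u \<in> C a K k - Q K (a + k)})"
    using order_trans[OF C_subset Q_subset] finite_U
    by (subst sum_card_swap[where B = U]) (auto simp: sum_distrib_left)
  also have "\<dots> = (\<Sum>u\<in>U. n * card {a. a < T \<and> u \<notin> Q K (a + k) \<and> (\<forall>j\<le>k. u \<in> Q K (a + n + j))})"
    by (intro sum.cong arg_cong2[of _ _ _ _ "(*)"] arg_cong[of _ _ card]) (auto simp: C_def)
  also have "\<dots> \<le> (\<Sum>u\<in>U. (n - k) * card {j. j < N \<and> u \<in> Q K j})"
    by (intro sum_mono card_gap_then_run_le k TN)
  also have "\<dots> = (n - k) * (\<Sum>j<N. card (Q K j))"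
    using Q_subset finite_U
    by (subst sum_card_swap[where B = U]) (auto simp: sum_distrib_left)
  finally have "real (n * (\<Sum>a<T. card (C a K k - Q K (a + k)))) \<le> real ((n - k) * (\<Sum>j<N. card (Q K j)))"
    by (rule of_nat_mono)
  then have 1: "(\<Sum>a<T. real (card (C a K k - Q K (a + k)))) \<le> real (n - k) / real n * (\<Sum>j<N. real (card (Q K j)))"
    using k by (simp add: field_simps)
  have "(\<Sum>a<T. real (card (C a K k))) \<le> (\<Sum>a<T. real (card (Q K (a + n))))"
    by (intro sum_mono of_nat_mono card_mono finite_Q C_subset)
  also have "\<dots> \<le> (\<Sum>j<N. real (card (Q K j)))"
    using TN by (intro sum_shift_le) auto
  finally have "\<eta> * (\<Sum>a<T. real (card (C a K k))) \<le> \<eta> * (\<Sum>j<N. real (card (Q K j)))"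
    using eta by (intro mult_left_mono) auto
  then show ?thesis using 1
    unfolding cost_def sum.distrib sum_distrib_left[symmetric] distrib_right by linarith
qed

text \<open>For \<open>K\<close> uniform on \<open>keyseqs\<close>, Jensen's inequality turns the
  Kraft bound into a bound on the mean logarithm of the code weight.\<close>

lemma block_entropy:
  assumes a: "a + 2 * n \<le> N" and ne: "keyseqs \<noteq> {}"
  shows "(\<Sum>K\<in>keyseqs. \<Sum>k<n. ln (weight K (a + k)) - ln (cost a K k))
    \<le> real (card keyseqs) * (ln (real (card M)) + real (N - n) * ln (real (card U)) - ln (real (card keyseqs)))"
proof -
  let ?V = "\<lambda>K. \<Prod>k<n. weight K (a + k) / cost a K k"
  have D: "0 < real (card keyseqs)" using ne finite_keyseqs by (simp add: card_gt_0_iff)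
  have Vpos: "0 < ?V K" if "K \<in> keyseqs" for K
    using that a by (intro prod_pos divide_pos_pos weight_pos cost_pos) auto
  have Spos: "0 < (\<Sum>K\<in>keyseqs. ?V K)" using finite_keyseqs ne Vpos by (intro sum_pos) auto
  then have "0 < real (card M) * real (card U) ^ (N - n)" using block_kraft[OF a] by linarith
  then have M: "0 < real (card M)" and U: "0 < real (card U) \<or> N - n = 0"
    by (auto simp: zero_less_mult_iff)
  have "(\<Sum>K\<in>keyseqs. \<Sum>k<n. ln (weight K (a + k)) - ln (cost a K k)) = (\<Sum>K\<in>keyseqs. ln (?V K))"
  proof (intro sum.cong refl)
    fix K assume K: "K \<in> keyseqs"
    have "ln (?V K) = (\<Sum>k<n. ln (weight K (a + k) / cost a K k))"
    proof (intro ln_prod)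
      fix k assume "k \<in> {..<n}"
      then show "weight K (a + k) / cost a K k \<noteq> 0"
        using weight_pos[of K "a + k"] cost_pos[OF K _ a, of k] by simp
    qed simp
    also have "\<dots> = (\<Sum>k<n. ln (weight K (a + k)) - ln (cost a K k))"
      using weight_pos cost_pos[OF K _ a] by (intro sum.cong refl) (simp add: ln_div less_imp_neq[symmetric])
    finally show "(\<Sum>k<n. ln (weight K (a + k)) - ln (cost a K k)) = ln (?V K)" by simp
  qed
  also have "\<dots> \<le> real (card keyseqs) * ln ((\<Sum>K\<in>keyseqs. ?V K) / real (card keyseqs))"
    by (intro sum_ln_le_ln_mean finite_keyseqs ne Vpos)
  also have "\<dots> \<le> real (card keyseqs) * ln (real (card M) * real (card U) ^ (N - n) / real (card keyseqs))"
    using D Spos block_kraft[OF a] by (intro mult_left_mono ln_mono divide_right_mono divide_pos_pos) auto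
  also have "ln (real (card M) * real (card U) ^ (N - n) / real (card keyseqs))
      = ln (real (card M)) + real (N - n) * ln (real (card U)) - ln (real (card keyseqs))"
    using U D M by (auto simp: ln_div ln_mult ln_realpow zero_less_mult_iff)
  finally show ?thesis .
qed

text \<open>Averages \<open>block_entropy\<close> over the block positions. For each
  \<open>k\<close>, Jensen's inequality over all pairs \<open>(a, K)\<close> moves the average
  inside \<open>ln (cost a K k)\<close>, where \<open>sum_cost_le\<close> applies. \<open>F\<close>
  and \<open>B\<close> sum over \<open>N\<close> times but are divided by \<open>T\<close>, which
  costs a factor \<open>N / T\<close>.\<close>

lemma entropy_bound:
  assumes TN: "T + 2 * n \<le> N" and T: "0 < T" and n: "0 < n" and ne: "keyseqs \<noteq> {}"
  defines "F \<equiv> (\<Sum>K\<in>keyseqs. \<Sum>j<N. real (card (Q K j))) / (real T * real (card keyseqs))"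
    and "B \<equiv> (\<Sum>K\<in>keyseqs. \<Sum>i<N. of_bool (K ! i \<in> Q K i)) / (real T * real (card keyseqs))"
  shows "0 < F"
    and "ln (real (card keyseqs)) - real (N - n) * ln (real (card U)) - real n * ln F
      - (\<Sum>k<n. ln (real (n - k) / real n + \<eta>)) - real n * ln (1 / \<eta>) * B \<le> ln (real (card M))"
proof -
  define D where "D = real (card keyseqs)"
  have D: "0 < D" using ne finite_keyseqs by (simp add: D_def card_gt_0_iff)
  have TD: "0 < real T * D" using T D by simp
  define I where "I = {..<T} \<times> keyseqs"
  have I: "finite I" "I \<noteq> {}" "real (card I) = real T * D"
    using finite_keyseqs ne T by (auto simp: I_def D_def card_cartesian_product)
  have cpos: "0 < cost (fst i) (snd i) k" if "i \<in> I" "k < n" for i k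
    using that TN by (intro cost_pos) (auto simp: I_def)
  have csum: "(\<Sum>i\<in>I. cost (fst i) (snd i) k) \<le> (real (n - k) / real n + \<eta>) * F * (real T * D)"
    if k: "k < n" for k
  proof -
    have "(\<Sum>i\<in>I. cost (fst i) (snd i) k) = (\<Sum>K\<in>keyseqs. \<Sum>a<T. cost a K k)"
      unfolding I_def by (subst sum.swap) (simp add: sum.cartesian_product case_prod_unfold)
    also have "\<dots> \<le> (\<Sum>K\<in>keyseqs. (real (n - k) / real n + \<eta>) * (\<Sum>j<N. real (card (Q K j))))"
      by (intro sum_mono sum_cost_le k TN)
    also have "\<dots> = (real (n - k) / real n + \<eta>) * F * (real T * D)"
      using TD T D by (simp add: F_def D_def sum_distrib_left)
    finally show ?thesis .
  qed
  have cf: "0 < real (n - k) / real n + \<eta>" for k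
    using eta by (intro add_nonneg_pos) auto
  show F: "0 < F"
  proof -
    have "0 < (\<Sum>i\<in>I. cost (fst i) (snd i) 0)" using I cpos n by (intro sum_pos) auto
    then have "0 < (real (n - 0) / real n + \<eta>) * F * (real T * D)" using csum[OF n] by linarith
    then show ?thesis using TD cf[of 0] by (simp add: zero_less_mult_iff)
  qed
  have cost_le: "(\<Sum>i\<in>I. ln (cost (fst i) (snd i) k))
      \<le> real T * D * (ln (real (n - k) / real n + \<eta>) + ln F)" if k: "k < n" for k
  proof -
    have "(\<Sum>i\<in>I. ln (cost (fst i) (snd i) k))
        \<le> real T * D * ln ((\<Sum>i\<in>I. cost (fst i) (snd i) k) / (real T * D))"
      unfolding I(3)[symmetric] using I k by (intro sum_ln_le_ln_mean cpos) auto
    also have "\<dots> \<le> real T * D * ln ((real (n - k) / real n + \<eta>) * F)"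
    proof (intro mult_left_mono ln_mono)
      have "0 < (\<Sum>i\<in>I. cost (fst i) (snd i) k)" using I cpos k by (intro sum_pos) auto
      then show "0 < (\<Sum>i\<in>I. cost (fst i) (snd i) k) / (real T * D)" using TD by simp
      show "(\<Sum>i\<in>I. cost (fst i) (snd i) k) / (real T * D) \<le> (real (n - k) / real n + \<eta>) * F"
        using csum[OF k] TD by (simp add: pos_divide_le_eq)
    qed (use TD in auto)
    also have "ln ((real (n - k) / real n + \<eta>) * F) = ln (real (n - k) / real n + \<eta>) + ln F"
      using F cf[of k] by (simp add: ln_mult)
    finally show ?thesis .
  qed
  \<comment> \<open>For each \<open>k\<close> an index is \<open>a + k\<close> for at most one
    \<open>a\<close>, so every key accepted too early is charged at most \<open>n\<close>
    times.\<close>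
  have weight_ge: "(\<Sum>i\<in>I. \<Sum>k<n. ln (weight (snd i) (fst i + k))) \<ge> - (real n * ln (1 / \<eta>) * B * (real T * D))"
  proof -
    let ?b = "\<lambda>K i. of_bool (K ! i \<in> Q K i) :: real"
    have lw: "ln (weight K i) = - (ln (1 / \<eta>) * ?b K i)" for K i
      using eta by (simp add: weight_def ln_div)
    have l0: "0 \<le> ln (1 / \<eta>)" using eta by simp
    have "(\<Sum>i\<in>I. \<Sum>k<n. ?b (snd i) (fst i + k)) = (\<Sum>K\<in>keyseqs. \<Sum>a<T. \<Sum>k<n. ?b K (a + k))"
      unfolding I_def by (subst sum.swap) (simp add: sum.cartesian_product case_prod_unfold)
    also have "\<dots> = (\<Sum>K\<in>keyseqs. \<Sum>k<n. \<Sum>a<T. ?b K (a + k))"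
      by (intro sum.cong refl sum.swap)
    also have "\<dots> \<le> (\<Sum>K\<in>keyseqs. \<Sum>k<n. \<Sum>i<N. ?b K i)"
      using TN by (intro sum_mono sum_shift_le) auto
    also have "\<dots> = real n * B * (real T * D)"
      using TD T D by (simp add: B_def D_def sum_distrib_left)
    finally have "ln (1 / \<eta>) * (\<Sum>i\<in>I. \<Sum>k<n. ?b (snd i) (fst i + k)) \<le> ln (1 / \<eta>) * (real n * B * (real T * D))"
      using l0 by (intro mult_left_mono) auto
    then show ?thesis
      unfolding lw sum_negf sum_distrib_left[symmetric] by (simp add: mult_ac)
  qed
  define W where "W = ln (real (card M)) + real (N - n) * ln (real (card U)) - ln D"
  have "(\<Sum>i\<in>I. \<Sum>k<n. ln (weight (snd i) (fst i + k)) - ln (cost (fst i) (snd i) k))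
      = (\<Sum>a<T. \<Sum>K\<in>keyseqs. \<Sum>k<n. ln (weight K (a + k)) - ln (cost a K k))"
    unfolding I_def using sum.cartesian_product[of "\<lambda>a K. \<Sum>k<n. ln (weight K (a + k)) - ln (cost a K k)"]
    by (simp add: case_prod_unfold)
  also have "\<dots> \<le> (\<Sum>a<T. D * W)"
    unfolding D_def W_def using TN ne by (intro sum_mono block_entropy) auto
  also have "\<dots> = real T * D * W" by simp
  finally have up: "(\<Sum>i\<in>I. \<Sum>k<n. ln (weight (snd i) (fst i + k)) - ln (cost (fst i) (snd i) k))
      \<le> real T * D * W" .
  have "(\<Sum>i\<in>I. \<Sum>k<n. ln (cost (fst i) (snd i) k)) = (\<Sum>k<n. \<Sum>i\<in>I. ln (cost (fst i) (snd i) k))"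
    by (rule sum.swap)
  also have "\<dots> \<le> (\<Sum>k<n. real T * D * (ln (real (n - k) / real n + \<eta>) + ln F))"
    by (intro sum_mono cost_le) auto
  also have "\<dots> = real T * D * ((\<Sum>k<n. ln (real (n - k) / real n + \<eta>)) + real n * ln F)"
    by (simp add: sum_distrib_left[symmetric] sum.distrib)
  finally have "real T * D * (- (real n * ln (1 / \<eta>) * B) - ((\<Sum>k<n. ln (real (n - k) / real n + \<eta>)) + real n * ln F))
      \<le> real T * D * W"
    using up weight_ge unfolding sum_subtractf by (simp add: right_diff_distrib mult.commute mult.left_commute)
  then have "- (real n * ln (1 / \<eta>) * B) - ((\<Sum>k<n. ln (real (n - k) / real n + \<eta>)) + real n * ln F) \<le> W"
    using TD by (simp only: mult_le_cancel_left_pos)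
  then show "ln (real (card keyseqs)) - real (N - n) * ln (real (card U)) - real n * ln F
      - (\<Sum>k<n. ln (real (n - k) / real n + \<eta>)) - real n * ln (1 / \<eta>) * B \<le> ln (real (card M))"
    unfolding W_def D_def by linarith
qed

end

section \<open>Fixing the tape and feeding the window to the filter\<close>

text \<open>
  As \<open>\<gamma>\<close> is fixed, the first variable stays within a factor close to \<open>1\<close> of its mean bound, while for
  the second one a constant factor is harmless. Applied to the tape, this makes the filter deterministic.
\<close>
lemma (in prob_space) exists_both_le:
  fixes X Y :: "'a \<Rightarrow> real"
  assumes "integrable M X" "integrable M Y" "expectation X \<le> x" "expectation Y \<le> y"
    and "\<And>\<omega>. 0 \<le> X \<omega>" "\<And>\<omega>. 0 \<le> Y \<omega>" and "0 < x" "0 < y" "0 < \<gamma>"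
  shows "\<exists>\<omega>\<in>space M. X \<omega> \<le> (1 + \<gamma>) * x \<and> Y \<omega> \<le> (1 + 1 / \<gamma>) * y"
proof -
  \<comment> \<open>Both summands are nonnegative, so \<open>Z \<omega> \<le> 1 + \<gamma>\<close>
    bounds each of them; dividing by \<open>\<gamma>\<close> gives the factor
    \<open>1 + 1 / \<gamma>\<close> for \<open>Y\<close>.\<close>
  define Z where "Z = (\<lambda>\<omega>. X \<omega> / x + \<gamma> * Y \<omega> / y)"
  have int: "integrable M Z" unfolding Z_def using assms by auto
  have "expectation Z = expectation X / x + \<gamma> * expectation Y / y"
    unfolding Z_def using assms by (subst Bochner_Integration.integral_add) auto
  also have "\<dots> \<le> 1 + \<gamma>"
    using assms by (intro add_mono) (auto simp: divide_le_eq)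
  finally have "\<not> (\<forall>\<omega>\<in>space M. 1 + \<gamma> < Z \<omega>)"
    using expectation_greater[OF int, of "1 + \<gamma>"] by (force intro: AE_I2)
  then obtain \<omega> where \<omega>: "\<omega> \<in> space M" "X \<omega> / x + \<gamma> * Y \<omega> / y \<le> 1 + \<gamma>"
    by (auto simp: Z_def not_less)
  have "0 \<le> X \<omega> / x" "0 \<le> \<gamma> * Y \<omega> / y" using assms by auto
  then have "X \<omega> / x \<le> 1 + \<gamma>" "\<gamma> * Y \<omega> / y \<le> 1 + \<gamma>" using \<omega>(2) by linarith+
  then have "X \<omega> \<le> (1 + \<gamma>) * x \<and> Y \<omega> \<le> (1 + 1 / \<gamma>) * y"
    using assms by (simp add: divide_le_eq field_simps)
  then show ?thesis using \<omega>(1) by blast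
qed

lemma prob_space_tape: "prob_space tape_space"
  unfolding tape_space_def by (intro prob_space_PiM) (rule measure_pmf.prob_space_axioms)

lemma space_tape: "space tape_space = UNIV"
  by (simp add: tape_space_def space_PiM)

text \<open>The update sequence behind \<open>window_run\<close>. The oldest key leaves before the
  next one enters, so the capacity is never exceeded.\<close>

primrec window_updates :: "nat \<Rightarrow> (nat \<Rightarrow> 'u) \<Rightarrow> nat \<Rightarrow> 'u update list" where
  "window_updates n K 0 = []"
| "window_updates n K (Suc i) =
    window_updates n K i @ (if i < n then [] else [Del (K (i - n))]) @ [Ins (K i)]"

lemma memory_after_window_updates:
  "memory_after A t (window_updates n K j)
    = window_run (alg_insert A t) (alg_delete A t) n K 0 j (alg_init A t)"
  by (induction j) (auto simp: memory_after_def Let_def)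

lemma length_window_updates: "length (window_updates n K j) \<le> 2 * j"
  by (induction j) auto

text \<open>Truncated subtraction makes the interval cover the filling phase \<open>j < n\<close> as
  well.\<close>

lemma keys_after_window_updates:
  assumes "inj_on K {..<j}" "0 < n"
  shows "keys_after (window_updates n K j) = K ` {j - n..<j}"
  using assms(1)
proof (induction j)
  case 0 then show ?case by (simp add: keys_after_def)
next
  case (Suc j)
  then have IH: "fold set_update (window_updates n K j) {} = K ` {j - n..<j}"
    by (simp add: keys_after_def inj_on_def)
  show ?case
  proof (cases "j < n")
    case True
    then have "{Suc j - n..<Suc j} = insert j {j - n..<j}" by auto
    then show ?thesis using IH True by (simp add: keys_after_def)
  next
    case False
    then have 1: "{Suc j - n..<Suc j} = insert j ({j - n..<j} - {j - n})"
      using assms(2) by auto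
    have "K ` ({j - n..<j} - {j - n}) = K ` {j - n..<j} - {K (j - n)}"
      using Suc.prems by (subst inj_on_image_set_diff[of K "{..<Suc j}"]) auto
    then show ?thesis using IH False unfolding 1 by (simp add: keys_after_def)
  qed
qed

lemma admissible_from_append:
  "admissible_from U n S (us @ vs)
    \<longleftrightarrow> admissible_from U n S us \<and> admissible_from U n (fold set_update us S) vs"
  by (induction U n S us rule: admissible_from.induct) auto

lemma admissible_window_updates:
  assumes "inj_on K {..<j}" "K ` {..<j} \<subseteq> U" "0 < n"
  shows "admissible U n (window_updates n K j)"
  using assms(1,2)
proof (induction j)
  case 0 then show ?case by (simp add: admissible_def)
next
  case (Suc j)
  then have inj: "inj_on K {..<j}" by (simp add: inj_on_def)
  then have IH: "admissible_from U n {} (window_updates n K j)"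
    using Suc.IH Suc.prems(2) by (auto simp: admissible_def image_subset_iff)
  have keys: "fold set_update (window_updates n K j) {} = K ` {j - n..<j}"
    using keys_after_window_updates[OF inj assms(3)] by (simp add: keys_after_def)
  have new: "K j \<notin> K ` {j - n..<j}" by (auto dest: inj_onD[OF Suc.prems(1)])
  have card: "card (insert (K j) (K ` I)) \<le> n" if "finite I" "card I < n" for I
    using card_insert_le_m1[of n "K ` I" "K j"] card_image_le[OF that(1), of K] that assms(3)
    by simp
  show ?case
  proof (cases "j < n")
    case True
    then show ?thesis using IH keys new Suc.prems(2) card[of "{j - n..<j}"]
      by (auto simp: admissible_def admissible_from_append)
  next
    case False
    have "K ` {j - n..<j} - {K (j - n)} = K ` ({j - n..<j} - {j - n})"
      using Suc.prems(1) by (subst inj_on_image_set_diff[of K "{..<Suc j}"]) auto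
    moreover have "card ({j - n..<j} - {j - n}) < n"
      using False assms(3) by (subst card_Diff_singleton) auto
    ultimately have "card (insert (K j) (K ` {j - n..<j} - {K (j - n)})) \<le> n"
      using card[of "{j - n..<j} - {j - n}"] by simp
    then show ?thesis using IH keys new Suc.prems(2) False assms(3)
      by (auto simp: admissible_def admissible_from_append)
  qed
qed

text \<open>
  Measurability comes for free: a set with positive \<^const>\<open>measure\<close> is measurable, since non-measurable
  sets get the junk value \<open>0\<close>.
\<close>
lemma filter_query_measurable:
  assumes "dynamic_filter A U n \<epsilon> l h" "admissible U n us" "length us \<le> l" "x \<in> U" "\<epsilon> < 1"
  shows "{t. alg_query A t x (memory_after A t us)} \<in> sets tape_space"
    and "x \<notin> keys_after us \<Longrightarrow> measure tape_space {t. alg_query A t x (memory_after A t us)} \<le> \<epsilon>"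
proof -
  interpret prob_space tape_space by (rule prob_space_tape)
  let ?Y = "{t. alg_query A t x (memory_after A t us)}"
  let ?N = "{t. \<not> alg_query A t x (memory_after A t us)}"
  have UN: "UNIV \<in> sets tape_space" using sets.top[of tape_space] by (simp add: space_tape)
  have Y: "?Y = space tape_space - ?N" by (auto simp: space_tape)
  have meas: "?N \<in> sets tape_space" and prob: "measure tape_space ?N \<ge> 1 - \<epsilon>" if "x \<notin> keys_after us"
  proof -
    show *: "measure tape_space ?N \<ge> 1 - \<epsilon>"
      using assms that by (simp add: dynamic_filter_def space_tape)
    show "?N \<in> sets tape_space"
    proof (rule ccontr)
      assume "?N \<notin> sets tape_space"
      then have "measure tape_space ?N = 0" by (rule measure_notin_sets)
      then show False using * assms(5) by simp
    qed
  qed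
  show "?Y \<in> sets tape_space"
  proof (cases "x \<in> keys_after us")
    case True
    then have "?Y = UNIV" using assms by (auto simp: dynamic_filter_def)
    then show ?thesis using UN by simp
  next
    case False
    then show ?thesis unfolding Y using meas by auto
  qed
  show "measure tape_space ?Y \<le> \<epsilon>" if "x \<notin> keys_after us"
    unfolding Y using prob_compl[OF meas[OF that]] prob[OF that] by simp
qed

text \<open>The falling factorial is bounded by its least factor. Thus distinctness of the keys
  loses little when \<open>U\<close> is large compared with \<open>N\<close>.\<close>

lemma card_distinct_lists_ge:
  assumes "finite U" "N \<le> card U"
  shows "(card U - N + 1) ^ N \<le> card {K. set K \<subseteq> U \<and> length K = N \<and> distinct K}"
proof -
  have "{K. set K \<subseteq> U \<and> length K = N \<and> distinct K} = {K. length K = N \<and> distinct K \<and> set K \<subseteq> U}"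
    by auto
  then have "card {K. set K \<subseteq> U \<and> length K = N \<and> distinct K} = \<Prod>{card U - N + 1..card U}"
    using card_lists_distinct_length_eq[OF assms] by simp
  also have "\<dots> \<ge> (\<Prod>i\<in>{card U - N + 1..card U}. card U - N + 1)"
    by (intro prod_mono) auto
  finally show ?thesis using assms(2) by simp
qed

text \<open>A single tape is chosen for all key sequences at once: \<open>X\<close> counts accepted
  keys and \<open>Y\<close> keys accepted before their insertion, both summed over all sequences and
  times. On that tape \<open>entropy_bound\<close> applies with the \<open>2 ^ h\<close>
  memories.\<close>

lemma dynamic_filter_entropy_bound:
  fixes A :: "'u filter_alg" and U :: "'u set"
  assumes filt: "dynamic_filter A U n \<epsilon> l h" and eps: "0 < \<epsilon>" "\<epsilon> < 1" and finU: "finite U"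
    and n: "0 < n" and T: "0 < T" and TN: "T + 2 * n \<le> N" and N: "2 * N \<le> l" "N \<le> card U"
    and eta: "0 < \<eta>" "\<eta> \<le> 1" and gam: "0 < \<gamma>"
  shows "ln (real (card {K. set K \<subseteq> U \<and> length K = N \<and> distinct K}))
      - real (N - n) * ln (real (card U))
      - real n * ln ((1 + \<gamma>) * (real N / real T) * (\<epsilon> * real (card U) + real n))
      - (\<Sum>k<n. ln (real (n - k) / real n + \<eta>))
      - real n * ln (1 / \<eta>) * ((1 + 1 / \<gamma>) * (real N / real T) * \<epsilon>) \<le> real h * ln 2"
proof -
  interpret tape: prob_space tape_space by (rule prob_space_tape)
  define D where "D = {K. set K \<subseteq> U \<and> length K = N \<and> distinct K}"
  define S where "S = (\<lambda>K j x. {t. alg_query A t x (memory_after A t (window_updates n ((!) K) j))})"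
  have finD: "finite D"
    by (rule finite_subset[OF _ finite_lists_length_eq[OF finU, of N]]) (auto simp: D_def)
  have "0 < card D"
    using card_distinct_lists_ge[OF finU N(2)] unfolding D_def[symmetric]
    by (rule less_le_trans[rotated]) simp
  then have D0: "D \<noteq> {}" and D: "0 < real (card D)" using finD by auto
  have ok: "admissible U n (window_updates n ((!) K) j)" "length (window_updates n ((!) K) j) \<le> l"
      "keys_after (window_updates n ((!) K) j) = (!) K ` {j - n..<j}"
    if "K \<in> D" "j \<le> N" for K j
  proof -
    have inj: "inj_on ((!) K) {..<j}"
      using that by (intro inj_on_subset[OF inj_on_nth[of K "{..<N}"]]) (auto simp: D_def)
    show "admissible U n (window_updates n ((!) K) j)"
      using that by (intro admissible_window_updates inj n) (auto simp: D_def)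
    show "length (window_updates n ((!) K) j) \<le> l"
      using length_window_updates[of n "(!) K" j] that N(1) by linarith
    show "keys_after (window_updates n ((!) K) j) = (!) K ` {j - n..<j}"
      by (rule keys_after_window_updates[OF inj n])
  qed
  have meas: "S K j x \<in> sets tape_space" if "K \<in> D" "j \<le> N" "x \<in> U" for K j x
    unfolding S_def using filter_query_measurable(1)[OF filt] ok[OF that(1,2)] that(3) eps by blast
  have prob: "measure tape_space (S K j x) \<le> \<epsilon>"
    if "K \<in> D" "j \<le> N" "x \<in> U" "x \<notin> (!) K ` {j - n..<j}" for K j x
    unfolding S_def using filter_query_measurable(2)[OF filt] ok[OF that(1,2)] that(3,4) eps by metis
  define X where "X = (\<lambda>t. \<Sum>K\<in>D. \<Sum>j<N. \<Sum>x\<in>U. indicator (S K j x) t :: real)"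
  define Y where "Y = (\<lambda>t. \<Sum>K\<in>D. \<Sum>i<N. indicator (S K i (K ! i)) t :: real)"
  have KU: "K ! i \<in> U" if "K \<in> D" "i < N" for K i using that by (auto simp: D_def)
  have int: "integrable tape_space (indicator (S K j x) :: tape \<Rightarrow> real)"
    if "K \<in> D" "j < N" "x \<in> U" for K j x
    using meas[of K j x] that by (simp add: tape.emeasure_finite less_top[symmetric])
  have EX: "tape.expectation X \<le> real (card D) * (real N * (\<epsilon> * real (card U) + real n))"
  proof -
    have "tape.expectation X = (\<Sum>K\<in>D. \<Sum>j<N. \<Sum>x\<in>U. measure tape_space (S K j x))"
      unfolding X_def using int
      by (subst Bochner_Integration.integral_sum; (intro sum.cong refl Bochner_Integration.integrable_sum)?)+
         (auto simp: space_tape)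
    also have "\<dots> \<le> (\<Sum>K\<in>D. \<Sum>j<N. \<epsilon> * real (card U) + real n)"
    proof (intro sum_mono)
      fix K j assume K: "K \<in> D" and j: "j \<in> {..<N}"
      let ?k = "(!) K ` {j - n..<j}"
      \<comment> \<open>For the at most \<open>n\<close> keys in the window the probability is
        bounded by 1.\<close>
      have "(\<Sum>x\<in>U. measure tape_space (S K j x)) \<le> (\<Sum>x\<in>U. \<epsilon> + of_bool (x \<in> ?k))"
        using prob[OF K, of j] j eps by (intro sum_mono) (force simp: tape.prob_le_1 add_increasing)
      also have "\<dots> = \<epsilon> * real (card U) + real (card (U \<inter> ?k))"
        using finU by (simp add: sum.distrib Int_def)
      also have "card (U \<inter> ?k) \<le> card {j - n..<j}"
        by (rule order_trans[OF card_mono card_image_le]) auto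
      finally show "(\<Sum>x\<in>U. measure tape_space (S K j x)) \<le> \<epsilon> * real (card U) + real n"
        by simp
    qed
    finally show ?thesis by simp
  qed
  have EY: "tape.expectation Y \<le> real (card D) * (real N * \<epsilon>)"
  proof -
    have "tape.expectation Y = (\<Sum>K\<in>D. \<Sum>i<N. measure tape_space (S K i (K ! i)))"
      unfolding Y_def using int KU
      by (subst Bochner_Integration.integral_sum; (intro sum.cong refl Bochner_Integration.integrable_sum)?)+
         (auto simp: space_tape)
    \<comment> \<open>Since \<open>K\<close> is distinct, \<open>K ! i\<close> is not among the keys
      inserted earlier, so accepting it is a false positive.\<close>
    also have "\<dots> \<le> (\<Sum>K\<in>D. \<Sum>i<N. \<epsilon>)"
      by (intro sum_mono prob) (auto simp: KU D_def nth_eq_iff_index_eq)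
    finally show ?thesis by simp
  qed
  have intX: "integrable tape_space X" and intY: "integrable tape_space Y"
    unfolding X_def Y_def using int KU by (auto intro!: Bochner_Integration.integrable_sum)
  have "0 < real (card D) * (real N * (\<epsilon> * real (card U) + real n))" "0 < real (card D) * (real N * \<epsilon>)"
    using D eps n TN by (auto intro!: mult_pos_pos add_nonneg_pos)
  then obtain t where t: "X t \<le> (1 + \<gamma>) * (real (card D) * (real N * (\<epsilon> * real (card U) + real n)))"
      "Y t \<le> (1 + 1 / \<gamma>) * (real (card D) * (real N * \<epsilon>))"
    using tape.exists_both_le[OF intX intY EX EY _ _ _ _ gam] by (auto simp: X_def Y_def sum_nonneg)
  define M where "M = {m :: bool list. length m = h}"
  have M: "finite M" "card M = 2 ^ h"
    using finite_lists_length_eq[of "UNIV :: bool set" h] card_lists_length_eq[of "UNIV :: bool set" h]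
    by (auto simp: M_def)
  let ?acc = "\<lambda>m. {x \<in> U. alg_query A t x m}"
  interpret sliding_window "alg_insert A t" "alg_delete A t" ?acc "alg_init A t" n N U M \<eta>
  proof
    show "K ! i \<in> ?acc (window_run (alg_insert A t) (alg_delete A t) n ((!) K) 0 j (alg_init A t))"
      if "set K \<subseteq> U" "length K = N" "distinct K" "j \<le> N" "i < j" "j \<le> i + n" for K i j
    proof -
      have K: "K \<in> D" using that by (simp add: D_def)
      have "K ! i \<in> keys_after (window_updates n ((!) K) j)"
        unfolding ok(3)[OF K that(4)] using that by auto
      then show ?thesis
        using filt ok(1,2)[OF K that(4)] KU[OF K, of i] that
        by (auto simp: dynamic_filter_def memory_after_window_updates)
    qed
  qed (use finU M eta filt in \<open>auto simp: M_def dynamic_filter_def uses_space_def\<close>)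
  have keyseqs: "keyseqs = D" by (simp add: keyseqs_def D_def)
  have Q: "Q K j = {x \<in> U. t \<in> S K j x}" for K j
    by (simp add: Q_def S_def memory_after_window_updates)
  define F where "F = (\<Sum>K\<in>keyseqs. \<Sum>j<N. real (card (Q K j))) / (real T * real (card keyseqs))"
  define B where "B = (\<Sum>K\<in>keyseqs. \<Sum>i<N. of_bool (K ! i \<in> Q K i)) / (real T * real (card keyseqs))"
  note bound = entropy_bound[OF TN T n, folded F_def B_def, unfolded keyseqs, OF D0]
  have "(\<Sum>K\<in>D. \<Sum>j<N. real (card (Q K j))) = X t"
    unfolding X_def Q using finU by (simp add: indicator_def Int_def)
  then have F: "F \<le> (1 + \<gamma>) * (real N / real T) * (\<epsilon> * real (card U) + real n)"
    unfolding F_def keyseqs using t(1) D T by (simp add: divide_le_eq mult_ac)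
  have "(\<Sum>K\<in>D. \<Sum>i<N. of_bool (K ! i \<in> Q K i)) = Y t"
    unfolding Y_def Q using KU by (intro sum.cong refl) (simp add: indicator_def)
  then have B: "B \<le> (1 + 1 / \<gamma>) * (real N / real T) * \<epsilon>"
    unfolding B_def keyseqs using t(2) D T by (simp add: divide_le_eq mult_ac)
  have "real n * ln F \<le> real n * ln ((1 + \<gamma>) * (real N / real T) * (\<epsilon> * real (card U) + real n))"
    using bound(1) F by (intro mult_left_mono ln_mono) auto
  moreover have "real n * ln (1 / \<eta>) * B \<le> real n * ln (1 / \<eta>) * ((1 + 1 / \<gamma>) * (real N / real T) * \<epsilon>)"
    using B eta by (intro mult_left_mono) auto
  moreover have "ln (real (card M)) = real h * ln 2" by (simp add: M ln_realpow)
  ultimately show ?thesis using bound(2) unfolding D_def by linarith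
qed

section \<open>Asymptotic evaluation\<close>

text \<open>A left Riemann sum of the increasing function \<open>ln\<close> over the interval from
  \<open>y\<close> to \<open>1 + y\<close> with step \<open>1 / n\<close>; its least argument, at
  \<open>k = n - 1\<close>, is \<open>y\<close>. The \<open>- 1\<close> yields the term with log
  e.\<close>

lemma sum_ln_shifted_le:
  fixes \<eta> :: real and n :: nat
  assumes n: "0 < n" and eta: "0 < \<eta>"
  defines "y \<equiv> \<eta> + 1 / real n"
  shows "(\<Sum>k<n. ln (real (n - k) / real n + \<eta>)) \<le> real n * ((1 + y) * ln (1 + y) - y * ln y - 1)"
proof -
  define x where "x = (\<lambda>i. real i / real n + y)"
  define G where "G = (\<lambda>x :: real. x * ln x - x)"  \<comment> \<open>antiderivative of \<open>ln\<close>\<close>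
  have x_pos: "0 < x i" for i
    using eta unfolding x_def y_def by (intro add_nonneg_pos add_pos_nonneg) auto
  have x_Suc: "x (Suc i) = x i + 1 / real n" for i by (simp add: x_def add_divide_distrib)
  have convex: "(b - a) * ln a \<le> G b - G a" if "0 < a" "0 < b" for a b :: real
  proof -
    have "ln (a / b) \<le> a / b - 1" using that by (intro ln_le_minus_one) auto
    then have "b * (ln a - ln b) \<le> b * (a / b - 1)" using that by (intro mult_left_mono) (auto simp: ln_div)
    then show ?thesis using that by (simp add: G_def algebra_simps)
  qed
  have "(\<Sum>k<n. ln (real (n - k) / real n + \<eta>)) = (\<Sum>k<n. ln (x (n - Suc k)))"
    by (intro sum.cong refl arg_cong[of _ _ ln]) (auto simp: x_def y_def of_nat_diff field_simps)
  also have "\<dots> = (\<Sum>i<n. ln (x i))" by (rule sum.nat_diff_reindex)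
  also have "\<dots> \<le> (\<Sum>i<n. real n * (G (x (Suc i)) - G (x i)))"
  proof (rule sum_mono)
    fix i
    have "real n * ((x (Suc i) - x i) * ln (x i)) \<le> real n * (G (x (Suc i)) - G (x i))"
      by (intro mult_left_mono convex x_pos) auto
    then show "ln (x i) \<le> real n * (G (x (Suc i)) - G (x i))" using n by (simp add: x_Suc)
  qed
  also have "\<dots> = real n * (G (x n) - G (x 0))"
    using sum_lessThan_telescope[of "\<lambda>i. G (x i)" n] by (simp add: sum_distrib_left[symmetric])
  also have "G (x n) - G (x 0) = (1 + y) * ln (1 + y) - y * ln y - 1"
    using n by (simp add: x_def G_def)
  finally show ?thesis .
qed

text \<open>
  The loss per key in nats, for \<open>\<eta> = \<gamma> = 1 / m\<close>, \<open>T = m n\<close> block positions, \<open>N = (m + 2) n\<close> insertions,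
  \<open>y = \<eta> + 1 / n\<close> and \<open>r = n / (\<epsilon> |U|)\<close>.
\<close>
definition deficit :: "nat \<Rightarrow> real \<Rightarrow> real \<Rightarrow> real \<Rightarrow> real" where
  "deficit m y r \<epsilon> = (1 + y) * ln (1 + y) - y * ln y + ln (1 + 1 / real m) + ln (1 + 2 / real m)
    + ln (1 + r) - (real m + 2) * ln (1 - (real m + 2) * (\<epsilon> * r))
    + ln (real m) * ((1 + real m) * (1 + 2 / real m) * \<epsilon>)"

text \<open>The powers of \<open>card U\<close> cancel: \<open>N\<close> from the key sequences,
  against \<open>N - n\<close> for the keys outside the block and \<open>n\<close> from the accepted
  sets. The condition on \<open>r\<close> says that the number \<open>N\<close> of keys is below
  \<open>card U\<close>.\<close>

lemma space_ge_deficit: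
  fixes U :: "'u set" and m :: nat
  assumes filt: "dynamic_filter A U n \<epsilon> l h" and eps: "0 < \<epsilon>" "\<epsilon> < 1" and finU: "finite U"
    and n: "0 < n" and m: "0 < m" and l: "2 * ((m + 2) * n) \<le> l"
  defines "r \<equiv> real n * inverse \<epsilon> / real (card U)"
  assumes r: "(real m + 2) * (\<epsilon> * r) < 1" and U: "0 < card U"
  shows "real n * ln (1 / \<epsilon>) + real n - real n * deficit m (1 / real m + 1 / real n) r \<epsilon> \<le> real h * ln 2"
proof -
  define u where "u = real (card U)"
  define N where "N = (m + 2) * n"
  define y where "y = 1 / real m + 1 / real n"
  have u: "0 < u" using U by (simp add: u_def)
  have er: "\<epsilon> * r = real n / u" using eps by (simp add: r_def u_def)
  have rpos: "0 < r" using eps n u by (simp add: r_def u_def)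
  have Nr: "real N / u = (real m + 2) * (\<epsilon> * r)" by (simp add: er N_def distrib_right)
  then have Nu: "real N < u" using r u pos_divide_less_eq[OF u, of "real N" 1] by simp
  then have NU: "N < card U" by (simp add: u_def)
  define D where "D = real (card {K. set K \<subseteq> U \<and> length K = N \<and> distinct K})"
  have bound: "ln D - real (N - n) * ln u
      - real n * ln ((1 + 1 / real m) * (real N / real (m * n)) * (\<epsilon> * u + real n))
      - (\<Sum>k<n. ln (real (n - k) / real n + 1 / real m))
      - real n * ln (1 / (1 / real m)) * ((1 + 1 / (1 / real m)) * (real N / real (m * n)) * \<epsilon>) \<le> real h * ln 2"
    unfolding D_def u_def using NU m n l
    by (intro dynamic_filter_entropy_bound[OF filt eps finU n]) (auto simp: N_def)
  have NT: "real N / real (m * n) = 1 + 2 / real m"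
    using n m by (simp add: N_def field_simps)
  have "real N * ln (u - real N) = ln (real ((card U - N) ^ N))"
    using NU by (simp add: u_def ln_realpow of_nat_diff)
  also have "\<dots> \<le> ln D"
  proof -
    have "(card U - N) ^ N \<le> (card U - N + 1) ^ N" by (intro power_mono) auto
    also note card_distinct_lists_ge[OF finU less_imp_le[OF NU]]
    finally show ?thesis unfolding D_def using NU by (intro ln_mono of_nat_mono) auto
  qed
  also have "u - real N = u * (1 - real N / u)" using u by (simp add: field_simps)
  also have "ln \<dots> = ln u + ln (1 - real N / u)" using u Nu by (simp add: ln_mult)
  finally have lnD: "real N * ln u + real N * ln (1 - real N / u) \<le> ln D" by (simp add: distrib_left)
  have Nn: "real (N - n) = real N - real n" by (simp add: N_def of_nat_diff)
  have "\<epsilon> * u + real n = \<epsilon> * (u * (1 + r))" using u eps by (simp add: r_def u_def field_simps)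
  then have lnF: "ln ((1 + 1 / real m) * (1 + 2 / real m) * (\<epsilon> * u + real n))
      = ln (1 + 1 / real m) + ln (1 + 2 / real m) - ln (1 / \<epsilon>) + ln u + ln (1 + r)"
    using eps u rpos m
    by (simp add: ln_mult ln_div add_pos_pos add_pos_nonneg less_imp_neq[symmetric])
  have sum: "(\<Sum>k<n. ln (real (n - k) / real n + 1 / real m)) \<le> real n * ((1 + y) * ln (1 + y) - y * ln y - 1)"
    unfolding y_def using m by (intro sum_ln_shifted_le n) auto
  define p q w where "p = (1 + y) * ln (1 + y) - y * ln y"
    and "q = (real m + 2) * ln (1 - (real m + 2) * (\<epsilon> * r))"
    and "w = ln (real m) * ((1 + real m) * (1 + 2 / real m) * \<epsilon>)"
  have "real N * ln (1 - real N / u) = real n * q"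
    unfolding Nr by (simp add: N_def q_def algebra_simps)
  moreover have "real n * ln (1 / (1 / real m)) * ((1 + 1 / (1 / real m)) * (1 + 2 / real m) * \<epsilon>) = real n * w"
    by (simp add: w_def)
  moreover have "deficit m y r \<epsilon> = p + ln (1 + 1 / real m) + ln (1 + 2 / real m) + ln (1 + r) - q + w"
    by (simp add: deficit_def p_def q_def w_def)
  then have "real n * deficit m y r \<epsilon> = real n * p + real n * ln (1 + 1 / real m)
      + real n * ln (1 + 2 / real m) + real n * ln (1 + r) - real n * q + real n * w"
    by (simp add: distrib_left right_diff_distrib)
  ultimately show ?thesis
    using bound lnD sum unfolding NT lnF Nn y_def[symmetric] p_def[symmetric]
    by (simp add: algebra_simps)
qed

text \<open>The limits are iterated, first \<open>n\<close> with \<open>m\<close> fixed and then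
  \<open>m\<close>: the last term of \<open>deficit\<close> grows with \<open>m\<close>, and no rate
  is given at which \<open>\<epsilon>\<close> vanishes.\<close>

lemma deficit_tendsto:
  assumes "(\<epsilon> \<longlongrightarrow> 0) sequentially" "(r \<longlongrightarrow> 0) sequentially" "0 < m"
  shows "(\<lambda>n. deficit m (1 / real m + 1 / real n) (r n) (\<epsilon> n)) \<longlonglongrightarrow> deficit m (1 / real m) 0 0"
proof -
  have "(\<lambda>n. 1 / real m + 1 / real n) \<longlonglongrightarrow> 1 / real m + 0"
    by (intro tendsto_add tendsto_const lim_1_over_n)
  moreover have "1 + 1 / real m \<noteq> 0" using assms(3) by (simp add: field_simps)
  ultimately show ?thesis unfolding deficit_def using assms
    by (intro tendsto_intros) (auto simp: add_pos_pos intro!: tendsto_eq_intros)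
qed

lemma deficit_limit: "(\<lambda>m. deficit m (1 / real m) 0 0) \<longlonglongrightarrow> 0"
  unfolding deficit_def by simp real_asymp

theorem theorem1:
  fixes \<epsilon> :: "nat \<Rightarrow> real" and U :: "nat \<Rightarrow> 'u set" and f :: "nat \<Rightarrow> nat"
  assumes "\<And>n. 0 < \<epsilon> n" and "\<And>n. \<epsilon> n < 1"
    and "\<epsilon> \<in> o(\<lambda>_. 1)"
    and "\<And>n. finite (U n)"
    and "(\<lambda>n. real (card (U n))) \<in> \<omega>(\<lambda>n. real n * inverse (\<epsilon> n))"
    and "(\<lambda>n. real (f n)) \<in> \<omega>(\<lambda>n. real n)"
  shows "\<exists>g :: nat \<Rightarrow> real. g \<in> o(\<lambda>n. real n) \<and>
    (\<forall>n h. \<forall>A :: 'u filter_alg. dynamic_filter A (U n) n (\<epsilon> n) (f n) h \<longrightarrow>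
       real h \<ge> real n * log 2 (inverse (\<epsilon> n)) + real n * log 2 (exp 1) - g n)"
proof -
  define b where "b = (\<lambda>n. real n * log 2 (inverse (\<epsilon> n)) + real n * log 2 (exp 1))"
  define H where "H = (\<lambda>n h. \<exists>A :: 'u filter_alg. dynamic_filter A (U n) n (\<epsilon> n) (f n) h)"
  \<comment> \<open>The shortfall of the least possible space, so that the bound holds by
    construction and only the growth of \<open>g\<close> remains to be shown. The value is 0 where
    no filter exists.\<close>
  define g where "g = (\<lambda>n. if \<exists>h. H n h then max 0 (b n - real (LEAST h. H n h)) else 0)"
  define r where "r = (\<lambda>n. real n * inverse (\<epsilon> n) / real (card (U n)))"
  have eps0: "\<epsilon> \<longlonglongrightarrow> 0" using smalloD_tendsto[OF assms(3)] by simp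
  have r0: "r \<longlonglongrightarrow> 0"
    unfolding r_def using assms(5) by (intro smalloD_tendsto) (simp add: smallomega_iff_smallo)
  have bound: "b n - real h \<le> g n" if "H n h" for n h
  proof -
    have "(LEAST h. H n h) \<le> h" using that by (rule Least_le)
    then show ?thesis using that unfolding g_def by auto
  qed
  have "g \<in> o(\<lambda>n. real n)"
  proof (rule landau_o.smallI)
    fix c :: real assume c: "0 < c"
    \<comment> \<open>\<open>m\<close> is fixed before \<open>n\<close> grows. The factor
      \<open>ln 2\<close> converts bits to nats.\<close>
    have "\<forall>\<^sub>F m in sequentially. deficit m (1 / real m) 0 0 < c * ln 2"
      using c by (intro order_tendstoD(2)[OF deficit_limit]) auto
    then have "\<forall>\<^sub>F m in sequentially. deficit m (1 / real m) 0 0 < c * ln 2 \<and> 0 < m"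
      using eventually_gt_at_top[of 0] by eventually_elim auto
    then obtain m where m: "deficit m (1 / real m) 0 0 < c * ln 2" "0 < m"
      by (auto dest: eventually_happens)
    have e1: "\<forall>\<^sub>F n in sequentially. deficit m (1 / real m + 1 / real n) (r n) (\<epsilon> n) < c * ln 2"
      by (rule order_tendstoD(2)[OF deficit_tendsto[OF eps0 r0 m(2)] m(1)])
    have "(\<lambda>n. (real m + 2) * (\<epsilon> n * r n)) \<longlonglongrightarrow> (real m + 2) * (0 * 0)"
      by (intro tendsto_intros eps0 r0)
    from order_tendstoD(2)[OF this, of 1] have e2: "\<forall>\<^sub>F n in sequentially. (real m + 2) * (\<epsilon> n * r n) < 1"
      by simp
    \<comment> \<open>The superlinear sequence length leaves room for \<open>2 * (m + 2) * n\<close>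
      updates, however large the fixed \<open>m\<close> is.\<close>
    have "(\<lambda>n. real n) \<in> o(\<lambda>n. real (f n))" using assms(6) by (simp add: smallomega_iff_smallo)
    then have e3: "\<forall>\<^sub>F n in sequentially. norm (real n) \<le> 1 / real (2 * (m + 2)) * norm (real (f n))"
      by (rule landau_o.smallD) simp
    \<comment> \<open>For positive \<open>n\<close> this makes \<open>U n\<close> nonempty.\<close>
    have e4: "\<forall>\<^sub>F n in sequentially. norm (real n * inverse (\<epsilon> n)) \<le> 1 * norm (real (card (U n)))"
      by (rule landau_o.smallD) (use assms(5) in \<open>auto simp: smallomega_iff_smallo\<close>)
    show "\<forall>\<^sub>F n in sequentially. norm (g n) \<le> c * norm (real n)"
      using e1 e2 e3 e4 eventually_gt_at_top[of 0]
    proof eventually_elim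
      case (elim n)
      have "b n - real h \<le> c * real n" if "H n h" for h
      proof -
        from that obtain A :: "'u filter_alg" where A: "dynamic_filter A (U n) n (\<epsilon> n) (f n) h"
          by (auto simp: H_def)
        have "real (2 * ((m + 2) * n)) \<le> real (f n)"
          using elim(3) by (simp add: field_simps)
        then have l: "2 * ((m + 2) * n) \<le> f n" by (simp only: of_nat_le_iff)
        have "0 < real n * inverse (\<epsilon> n)" using elim(5) assms(1)[of n] by simp
        then have "0 < card (U n)" using elim(4) by (auto intro!: Nat.gr0I)
        then have "real n * ln (1 / \<epsilon> n) + real n
            - real n * deficit m (1 / real m + 1 / real n) (r n) (\<epsilon> n) \<le> real h * ln 2"
          unfolding r_def using elim(2)[unfolded r_def]
          by (intro space_ge_deficit[OF A assms(1,2,4) elim(5) m(2) l])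
        moreover have "b n * ln 2 = real n * ln (1 / \<epsilon> n) + real n"
          by (simp add: b_def log_def inverse_eq_divide field_simps)
        moreover have "real n * deficit m (1 / real m + 1 / real n) (r n) (\<epsilon> n) \<le> real n * (c * ln 2)"
          using elim(1) by (intro mult_left_mono) auto
        ultimately have "(b n - real h) * ln 2 \<le> c * real n * ln 2"
          by (simp add: algebra_simps)
        then show ?thesis by simp
      qed
      then have "g n \<le> c * real n"
        unfolding g_def using c LeastI_ex[of "H n"] by auto
      moreover have "0 \<le> g n" by (simp add: g_def)
      ultimately show ?case by simp
    qed
  qed
  then show ?thesis
    using bound unfolding b_def H_def by (intro exI[of _ g]) (force simp: algebra_simps)
qed

end
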